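(* Let $R$ be a finite ring with non-commuting graph $\Gamma_R$. Then (a) $\Gamma_R$ is connected; (b) $\Gamma_R$ is the empty graph if and only if $R$ is commutative.
   Context: Rings are associative and not assumed to have a unity. For a ring $R$, $Z(R)=\{x\in R : xr=rx \text{ for all } r\in R\}$ is its center. The non-commuting graph $\Gamma_R$ of a finite ring $R$ is the simple undirected graph with vertex set $R\setminus Z(R)$ in which two distinct vertices $a,b$ are adjacent if and only if $ab\neq ba$. A graph is connected if any two of its vertices are joined by a path (so the graph with no vertices is, vacuously, connected). The empty graph is the graph with no vertices. *)

theory Defs
  imports "Graph_Theory.Graph_Theory"
begin

text \<open>
  The type class \<open>ring\<close> is that of associative rings that need not have a unity; a finite ring is
  a type of sort \<open>{finite, ring}\<close>.
\<close>

definition ring_center :: "'a::ring set" where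
  "ring_center = {x. \<forall>r. x * r = r * x}"

text \<open>
  A simple undirected graph is represented as a symmetric loop-free digraph whose arcs are pairs of
  vertices: every edge contributes both of its orientations.
\<close>

definition non_commuting_graph :: "'a::ring pair_pre_digraph" where
  "non_commuting_graph =
     \<lparr> pverts = UNIV - ring_center,
       parcs = {(a, b). a \<in> UNIV - ring_center \<and> b \<in> UNIV - ring_center \<and>
                        a \<noteq> b \<and> a * b \<noteq> b * a} \<rparr>"

lemma pair_graph_non_commuting_graph:
  "pair_graph (non_commuting_graph :: 'a::{finite, ring} pair_pre_digraph)"
  by unfold_locales (auto simp: non_commuting_graph_def symmetric_def intro: symI)

text \<open>
  The library's \<open>connected\<close> additionally requires a nonempty vertex set, whereas here the graph
  without vertices counts as connected.
\<close>

definition graph_connected :: "'a pair_pre_digraph \<Rightarrow> bool" where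
  "graph_connected G \<longleftrightarrow>
     (\<forall>u \<in> pverts G. \<forall>v \<in> pverts G. \<exists>p. pre_digraph.apath (with_proj G) u p v)"

lemma graph_connected_iff_connected:
  assumes "pair_sym_digraph G"
  shows "graph_connected G \<longleftrightarrow> pverts G = {} \<or> connected (with_proj G)"
proof -
  interpret pair_sym_digraph G by fact
  have "connected (with_proj G) \<longleftrightarrow> strongly_connected (with_proj G)"
    using reachable_mk_symmetric_eq[OF pair_sym_arcs]
    by (simp add: connected_def strongly_connected_def)
  moreover have "(\<exists>p. apath u p v) \<longleftrightarrow> u \<rightarrow>\<^sup>*\<^bsub>with_proj G\<^esub> v" for u v
    using reachable_apath by auto
  ultimately show ?thesis
    by (auto simp: graph_connected_def strongly_connected_def)
qed

end

theory Submission
  imports Defs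
begin

text \<open>
  The centralizers of two noncentral elements \<open>a\<close> and \<open>b\<close> are proper subgroups of the additive
  group of the ring, and a group is never the union of two proper subgroups. Hence some \<open>x\<close> commutes
  with neither \<open>a\<close> nor \<open>b\<close>; this \<open>x\<close> is itself noncentral, so \<open>a\<close>, \<open>x\<close>, \<open>b\<close> is a walk in the
  non-commuting graph. Any two vertices therefore have a common neighbour, which gives
  connectedness. The graph has no vertices exactly when every element is central, that is, when
  the ring is commutative.
\<close>

text \<open>
  If \<open>x\<close> lies outside the centralizer of \<open>a\<close> and \<open>y\<close> outside that of \<open>b\<close>, then one of \<open>x\<close>, \<open>y\<close>,
  \<open>x + y\<close> lies outside both: when \<open>x\<close> commutes with \<open>b\<close> and \<open>y\<close> commutes with \<open>a\<close>, the commutator of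
  \<open>x + y\<close> with \<open>a\<close> is that of \<open>x\<close>, and its commutator with \<open>b\<close> is that of \<open>y\<close>.
\<close>

lemma noncentral_common_noncommuting:
  fixes a b :: "'a::ring"
  assumes "a \<notin> ring_center" and "b \<notin> ring_center"
  obtains x where "a * x \<noteq> x * a" and "b * x \<noteq> x * b"
proof -
  obtain x y where x: "a * x \<noteq> x * a" and y: "b * y \<noteq> y * b"
    using assms by (auto simp: ring_center_def)
  show thesis
  proof (cases "b * x = x * b \<and> a * y = y * a")
    case True
    then have "a * (x + y) \<noteq> (x + y) * a" and "b * (x + y) \<noteq> (x + y) * b"
      using x y by (simp_all add: distrib_left distrib_right)
    then show thesis by (rule that)
  next
    case False
    then show thesis using x y that by blast
  qed
qed

lemma non_commuting_graph_arcI: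
  fixes a x :: "'a::ring"
  assumes "a * x \<noteq> x * a"
  shows "(a, x) \<in> parcs non_commuting_graph"
proof -
  have "a \<notin> ring_center"
    using assms unfolding ring_center_def by blast
  moreover have "x \<notin> ring_center"
    using assms[symmetric] unfolding ring_center_def by blast
  moreover have "a \<noteq> x"
    using assms by blast
  ultimately show ?thesis
    using assms by (auto simp: non_commuting_graph_def)
qed

theorem proposition2p1:
  shows "graph_connected (non_commuting_graph :: 'a::{finite, ring} pair_pre_digraph) \<and>
         (pverts (non_commuting_graph :: 'a pair_pre_digraph) = {} \<longleftrightarrow>
            (\<forall>x y :: 'a. x * y = y * x))"
proof
  let ?G = "non_commuting_graph :: 'a pair_pre_digraph"
  interpret pair_graph ?G by (rule pair_graph_non_commuting_graph)
  show "graph_connected ?G"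
    unfolding graph_connected_def
  proof (intro ballI)
    fix a b assume "a \<in> pverts ?G" and "b \<in> pverts ?G"
    then have "a \<notin> ring_center" and "b \<notin> ring_center"
      by (simp_all add: non_commuting_graph_def)
    then obtain x where ax: "a * x \<noteq> x * a" and bx: "b * x \<noteq> x * b"
      by (rule noncentral_common_noncommuting)
    have "(a, x) \<in> parcs ?G" using ax by (rule non_commuting_graph_arcI)
    moreover have "(x, b) \<in> parcs ?G" using bx[symmetric] by (rule non_commuting_graph_arcI)
    ultimately have "a \<rightarrow>\<^sup>*\<^bsub>with_proj ?G\<^esub> b"
      by (rule adj_reachable_trans[OF _ reachable_adjI])
    then show "\<exists>p. apath a p b"
      by (simp only: reachable_apath)
  qed
  show "pverts ?G = {} \<longleftrightarrow> (\<forall>x y :: 'a. x * y = y * x)"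
    by (auto simp: non_commuting_graph_def ring_center_def)
qed

end
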